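(* Let $d\ge1$, $0\le r\le d$, let $\Gamma=\mathbb{Z}\omega_1+\cdots+\mathbb{Z}\omega_r$ be a discrete subgroup of rank $r$ of $(\mathbb{R}^d,+)$, with $\omega_1,\dots,\omega_r$ being $\mathbb{R}$-linearly independent, let $\nu>0$, and let $\chi$ be a character of $\Gamma$ with values in the unit circle, written $\chi(\gamma)=e^{2i\pi\langle\gamma,v_\chi\rangle}$ for $\gamma\in\Gamma$, with $v_\chi=\beta_1\omega_1+\cdots+\beta_r\omega_r\in\mathbb{V}_\Gamma$; put $\beta_\chi=(\beta_1,\dots,\beta_r)\in\mathbb{R}^r$ and $G=(\langle\omega_i,\omega_j\rangle)_{1\le i,j\le r}$. Then for every $\varphi\in L^{2,\nu}_{\Gamma,\chi}(\mathbb{R}^d)$ the Segal-Bargmann transform $\mathcal{B}\varphi$ is also given by $$[\mathcal{B}\varphi](z)=\int_{\Lambda(\Gamma)}A^\nu_{\Gamma,\chi}(z;x)\,\varphi(x)\,e^{-\nu\|x\|^2}d\lambda(x),\qquad z\in\mathbb{C}^d,$$ where $$A^\nu_{\Gamma,\chi}(z;x)=\left(\frac{\nu}{\pi}\right)^{\frac{3d}{4}}e^{\sqrt2\nu\langle z,x\rangle-\frac{\nu}{2}\langle z,z\rangle}\,\Theta_{0,G\beta_\chi}\left(\frac{i\nu}{2\pi}G(x_1-\sqrt2 z_1)\,\Big|\,\frac{i\nu}{2\pi}G\right).$$ Here $x=x_1+x_2\in\mathbb{V}_\Gamma\oplus\mathbb{V}_\Gamma^\perp$ and $z=z_1+z_2\in\mathbb{V}_{\mathbb{C}}\oplus\mathbb{V}_{\mathbb{C}}^{\perp_H}$,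 and inside $\Theta$ the vectors $x_1$, $z_1$ are identified with their coordinate vectors in $\mathbb{R}^r$, $\mathbb{C}^r$ relative to the basis $\omega_1,\dots,\omega_r$.
   Context: $\langle\cdot,\cdot\rangle$ and $\|\cdot\|$ are the usual scalar product and norm on $\mathbb{R}^d$; $\langle\cdot,\cdot\rangle$ also denotes the $\mathbb{C}$-bilinear extension $\langle z,w\rangle=\sum_j z_jw_j$ to $\mathbb{C}^d$. $d\lambda$ is Lebesgue measure. $\mathbb{V}_\Gamma=\mathrm{Span}_{\mathbb{R}}(\Gamma)$, $\mathbb{V}_\Gamma^\perp$ is its orthogonal complement in $\mathbb{R}^d$, $\mathbb{V}_{\mathbb{C}}=\mathbb{V}_\Gamma+i\mathbb{V}_\Gamma$ and $\mathbb{V}_{\mathbb{C}}^{\perp_H}=\mathbb{V}_\Gamma^\perp+i\mathbb{V}_\Gamma^\perp$. A character satisfies $\chi(\gamma+\gamma')=\chi(\gamma)\chi(\gamma')$. $\Lambda(\Gamma)=\Lambda_1(\Gamma)\times\mathbb{V}_\Gamma^\perp$ is a fundamental domain of $\Gamma$ in $\mathbb{R}^d$, with $\Lambda_1(\Gamma)$ a compact fundamental domain of $\Gamma$ in $\mathbb{V}_\Gamma$. $L^{2,\nu}_{\Gamma,\chi}(\mathbb{R}^d)$ is the space of (classes, modulo a.e. equality, of) Borel measurable functions $f:\mathbb{R}^d\to\mathbb{C}$ such that $f(x+\gamma)=\chi(\gamma)e^{\nu\langle x+\gamma/2,\gamma\rangle}f(x)$ for almost every $x\in\mathbb{R}^d$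 and every $\gamma\in\Gamma$, and $\int_{\Lambda(\Gamma)}|f(x)|^2e^{-\nu\|x\|^2}d\lambda(x)<\infty$. The Segal-Bargmann transform is $[\mathcal{B}\varphi](z)=\left(\frac{\nu}{\pi}\right)^{3d/4}\int_{\mathbb{R}^d}e^{\sqrt2\nu\langle z,x\rangle-\frac{\nu}{2}\langle z,z\rangle}\varphi(x)e^{-\nu\|x\|^2}d\lambda(x)$, $z\in\mathbb{C}^d$. The Riemann theta function with characteristics $\alpha,\beta\in\mathbb{R}^r$ is, for $\Omega\in\mathbb{C}^{r\times r}$ symmetric with positive definite imaginary part and $w\in\mathbb{C}^r$, $\Theta_{\alpha,\beta}(w\,|\,\Omega)=\sum_{n\in\mathbb{Z}^r}e^{2i\pi\left\{\frac12(\alpha+n)\Omega(\alpha+n)+(\alpha+n)(w+\beta)\right\}}$, where $u\Omega u={}^t u\,\Omega\,u$ and $uv={}^tu\,v$ (no conjugation). *)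

theory Defs
  imports "HOL-Analysis.Analysis"
begin

text \<open>
  The ambient space is \<open>real ^ 'd\<close>.  Vectors and matrices whose size is the rank \<open>r\<close>
  (possibly \<open>0\<close>) are functions on \<open>nat\<close> of which only the values at indices \<open>i < r\<close> matter.
\<close>

definition lattice :: "nat \<Rightarrow> (nat \<Rightarrow> real ^ 'd) \<Rightarrow> (real ^ 'd) set" where
  "lattice r \<omega> = {\<Sum>i<r. of_int (n i) *\<^sub>R \<omega> i | n :: nat \<Rightarrow> int. True}"

definition cvec :: "real ^ 'd \<Rightarrow> complex ^ 'd" where
  "cvec x = (\<chi> j. complex_of_real (x $ j))"

text \<open>The bilinear (not Hermitian) extension of the scalar product.\<close>

definition cdot :: "complex ^ 'd \<Rightarrow> complex ^ 'd \<Rightarrow> complex" where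
  "cdot z w = (\<Sum>j\<in>UNIV. z $ j * w $ j)"

definition complexify :: "(real ^ 'd) set \<Rightarrow> (complex ^ 'd) set" where
  "complexify V = {cvec x + \<i> *s cvec y | x y. x \<in> V \<and> y \<in> V}"

text \<open>The summand in \<open>V\<close> of \<open>x\<close>, for a direct sum decomposition of the space into \<open>V\<close> and \<open>W\<close>.\<close>

definition summand :: "'a::ab_group_add set \<Rightarrow> 'a set \<Rightarrow> 'a \<Rightarrow> 'a" where
  "summand V W x = (THE y. y \<in> V \<and> x - y \<in> W)"

definition unitary_character :: "(real ^ 'd) set \<Rightarrow> (real ^ 'd \<Rightarrow> complex) \<Rightarrow> bool" where
  "unitary_character \<Gamma> ch \<longleftrightarrow>
     (\<forall>\<gamma>\<in>\<Gamma>. \<forall>\<gamma>'\<in>\<Gamma>. ch (\<gamma> + \<gamma>') = ch \<gamma> * ch \<gamma>') \<and> (\<forall>\<gamma>\<in>\<Gamma>. cmod (ch \<gamma>) = 1)"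

definition cylinder :: "(real ^ 'd) set \<Rightarrow> (real ^ 'd) set \<Rightarrow> (real ^ 'd) set" where
  "cylinder V A = {x1 + x2 | x1 x2. x1 \<in> A \<and> x2 \<in> V\<^sup>\<bottom>}"

text \<open>
  The translates of \<open>D\<close> by \<open>\<Gamma>\<close> cover \<open>V\<close> and overlap only in null sets for the Lebesgue measure
  of the subspace \<open>V\<close>.  By Fubini, a subset of \<open>V\<close> is null for that measure iff its product with
  the orthogonal complement of \<open>V\<close> is a null set of the ambient space.  For \<open>V = UNIV\<close> the
  complement is \<open>{0}\<close> and one gets ordinary null sets.
\<close>

definition compact_fundamental_domain ::
    "(real ^ 'd) set \<Rightarrow> (real ^ 'd) set \<Rightarrow> (real ^ 'd) set \<Rightarrow> bool" where
  "compact_fundamental_domain \<Gamma> V D \<longleftrightarrow>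
     compact D \<and> D \<subseteq> V \<and> (\<Union>\<gamma>\<in>\<Gamma>. (+) \<gamma> ` D) = V \<and>
     (\<forall>\<gamma>\<in>\<Gamma>. \<forall>\<gamma>'\<in>\<Gamma>. \<gamma> \<noteq> \<gamma>' \<longrightarrow> negligible (cylinder V ((+) \<gamma> ` D \<inter> (+) \<gamma>' ` D)))"

text \<open>
  Representatives of the classes in $L^{2,\nu}_{\Gamma,\chi}$; \<open>\<Lambda>\<close> is the fundamental domain of
  \<open>\<Gamma>\<close> in the ambient space.
\<close>

definition L2_space ::
    "real \<Rightarrow> (real ^ 'd) set \<Rightarrow> (real ^ 'd \<Rightarrow> complex) \<Rightarrow> (real ^ 'd) set \<Rightarrow> (real ^ 'd \<Rightarrow> complex) set"
  where
  "L2_space \<nu> \<Gamma> ch \<Lambda> = {f. f \<in> borel_measurable borel \<and>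
     (\<forall>\<gamma>\<in>\<Gamma>. AE x in lborel.
        f (x + \<gamma>) = ch \<gamma> * complex_of_real (exp (\<nu> * inner (x + \<gamma> /\<^sub>R 2) \<gamma>)) * f x) \<and>
     (\<integral>\<^sup>+x\<in>\<Lambda>. ennreal ((cmod (f x))\<^sup>2 * exp (- \<nu> * (norm x)\<^sup>2)) \<partial>lborel) < \<infinity>}"

definition bargmann_kernel :: "real \<Rightarrow> complex ^ 'd \<Rightarrow> real ^ 'd \<Rightarrow> complex" where
  "bargmann_kernel \<nu> z x =
     exp (complex_of_real (sqrt 2 * \<nu>) * cdot z (cvec x) - complex_of_real (\<nu> / 2) * cdot z z)"

definition segal_bargmann :: "real \<Rightarrow> (real ^ 'd \<Rightarrow> complex) \<Rightarrow> complex ^ 'd \<Rightarrow> complex" where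
  "segal_bargmann \<nu> \<phi> z =
     complex_of_real ((\<nu> / pi) powr (3 * real CARD('d) / 4)) *
     (LINT x|lborel. bargmann_kernel \<nu> z x * \<phi> x * complex_of_real (exp (- \<nu> * (norm x)\<^sup>2)))"

text \<open>
  \<open>riemann_theta r \<alpha> \<beta> w \<Omega>\<close>.  Extensional functions on \<open>{..<r}\<close> represent each element of
  $\mathbb{Z}^r$ exactly once.
\<close>

definition riemann_theta ::
    "nat \<Rightarrow> (nat \<Rightarrow> real) \<Rightarrow> (nat \<Rightarrow> real) \<Rightarrow> (nat \<Rightarrow> complex) \<Rightarrow> (nat \<Rightarrow> nat \<Rightarrow> complex) \<Rightarrow> complex"
  where
  "riemann_theta r \<alpha> \<beta> w \<Omega> =
     (\<Sum>\<^sub>\<infinity>n\<in>{..<r} \<rightarrow>\<^sub>E (UNIV :: int set).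
        exp (2 * \<i> * complex_of_real pi *
          (1 / 2 * (\<Sum>i<r. \<Sum>j<r. complex_of_real (\<alpha> i + of_int (n i)) * \<Omega> i j *
                                   complex_of_real (\<alpha> j + of_int (n j))) +
           (\<Sum>i<r. complex_of_real (\<alpha> i + of_int (n i)) * (w i + complex_of_real (\<beta> i))))))"

definition gram :: "(nat \<Rightarrow> real ^ 'd) \<Rightarrow> nat \<Rightarrow> nat \<Rightarrow> real" where
  "gram \<omega> i j = inner (\<omega> i) (\<omega> j)"

text \<open>
  The coordinates, relative to \<open>\<omega> 0, \<dots>, \<omega> (r - 1)\<close>, of the components of \<open>x\<close> in the real span
  and of \<open>z\<close> in the complex span.
\<close>

definition real_coords :: "nat \<Rightarrow> (nat \<Rightarrow> real ^ 'd) \<Rightarrow> real ^ 'd \<Rightarrow> nat \<Rightarrow> real" where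
  "real_coords r \<omega> x i =
     (let B = \<omega> ` {..<r}; V = span B
      in representation B (summand V (V\<^sup>\<bottom>) x) (\<omega> i))"

definition complex_coords :: "nat \<Rightarrow> (nat \<Rightarrow> real ^ 'd) \<Rightarrow> complex ^ 'd \<Rightarrow> nat \<Rightarrow> complex" where
  "complex_coords r \<omega> z i =
     (let B = \<omega> ` {..<r}; V = span B
      in vec.representation (cvec ` B)
           (summand (complexify V) (complexify (V\<^sup>\<bottom>)) z) (cvec (\<omega> i)))"

definition theta_kernel ::
    "real \<Rightarrow> nat \<Rightarrow> (nat \<Rightarrow> real ^ 'd) \<Rightarrow> (nat \<Rightarrow> real) \<Rightarrow> complex ^ 'd \<Rightarrow> real ^ 'd \<Rightarrow> complex" where
  "theta_kernel \<nu> r \<omega> \<beta> z x =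
     complex_of_real ((\<nu> / pi) powr (3 * real CARD('d) / 4)) * bargmann_kernel \<nu> z x *
     riemann_theta r (\<lambda>_. 0) (\<lambda>i. \<Sum>j<r. gram \<omega> i j * \<beta> j)
       (\<lambda>i. \<i> * complex_of_real (\<nu> / (2 * pi)) *
         (\<Sum>j<r. complex_of_real (gram \<omega> i j) *
            (complex_of_real (real_coords r \<omega> x j)
              - complex_of_real (sqrt 2) * complex_coords r \<omega> z j)))
       (\<lambda>i j. \<i> * complex_of_real (\<nu> / (2 * pi)) * complex_of_real (gram \<omega> i j))"

end

theory Submission
  imports Defs "HOL-Probability.Distributions"
begin

text \<open>
  Translating the integrand of the transform by \<open>\<gamma> \<in> \<Gamma>\<close> multiplies it by
  \<open>ch \<gamma> * exp (sqrt 2 * \<nu> * \<langle>z, \<gamma>\<rangle> - \<nu> * \<langle>x, \<gamma>\<rangle> - \<nu> / 2 * \<parallel>\<gamma>\<parallel>\<^sup>2)\<close>, so the integral over the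
  whole space unfolds to an integral over the fundamental domain against the sum of these factors.
  With \<open>\<gamma> = \<Sum> n\<^sub>i \<omega>\<^sub>i\<close> this sum is the theta series.  Because \<open>\<langle>x, \<gamma>\<rangle>\<close> sees only the component
  of \<open>x\<close> in the compact \<open>\<Lambda>1\<close>, the factors are dominated on \<open>\<Lambda>\<close> by a summable sequence that
  does not depend on \<open>x\<close>; and the integrand is integrable on \<open>\<Lambda>\<close> since both the kernel and
  \<open>\<phi>\<close> are square integrable there for the Gaussian weight.
\<close>

section \<open>Unfolding an integral over a tiling\<close>

text \<open>The theta function is an unordered sum, whereas Fubini needs a Bochner integral over
  counting measure; absolute summability makes the two agree.\<close>

lemma infsum_eq_integral_count_space:
  fixes f :: "'i \<Rightarrow> 'b::{banach, second_countable_topology}"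
  assumes "integrable (count_space I) f"
  shows "infsum f I = (\<integral>i. f i \<partial>count_space I)"
  using assms infsetsum_infsum[of f I]
  by (simp add: infsetsum_def abs_summable_on_def abs_summable_equivalent)

text \<open>Fubini on \<open>count_space I\<close> times \<open>lborel\<close>. The factors
  \<open>e i\<close> may depend on the point because \<open>g\<close> is only quasi-periodic, while
  the bounds \<open>E i\<close> do not, so summing \<open>E\<close> against the integral of
  \<open>k\<close> over \<open>D\<close> controls everything. Global integrability of
  \<open>g\<close> is therefore a conclusion.\<close>

lemma integral_unfold_tiling:
  fixes g k :: "'a::euclidean_space \<Rightarrow> complex" and e :: "'i \<Rightarrow> 'a \<Rightarrow> complex"
  assumes I: "countable I" and D [measurable]: "D \<in> sets borel"
    and g [measurable]: "g \<in> borel_measurable borel"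
    and tiling: "AE x in lborel. \<exists>!i. i \<in> I \<and> x - t i \<in> D"
    and k: "set_integrable lborel D k"
    and e [measurable]: "\<And>i. i \<in> I \<Longrightarrow> e i \<in> borel_measurable borel"
    and quasi: "\<And>i. i \<in> I \<Longrightarrow> AE x in lborel. g (x + t i) = e i x * k x"
    and bound: "\<And>i x. i \<in> I \<Longrightarrow> x \<in> D \<Longrightarrow> norm (e i x) \<le> E i"
    and E: "integrable (count_space I) E"
  shows "integrable lborel g"
    and "set_integrable lborel D (\<lambda>x. (\<Sum>\<^sub>\<infinity>i\<in>I. e i x) * k x)"
    and "integral\<^sup>L lborel g = (LINT x:D|lborel. (\<Sum>\<^sub>\<infinity>i\<in>I. e i x) * k x)"
proof -
  interpret C: sigma_finite_measure "count_space I"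
    by (rule sigma_finite_measure_count_space_countable[OF I])
  interpret P: pair_sigma_finite "count_space I" "lborel :: 'a measure" ..
  let ?P = "count_space I \<Otimes>\<^sub>M (lborel :: 'a measure)"
  define kD where "kD x = indicator D x *\<^sub>R k x" for x
  define F where "F i x = e i x * kD x" for i x
  define G where "G i y = indicator D (y - t i) *\<^sub>R g y" for i y
  have kD: "integrable lborel kD" using k by (simp add: kD_def[abs_def] set_integrable_def)
  hence [measurable]: "kD \<in> borel_measurable borel" by simp
  have Fm [measurable]: "F i \<in> borel_measurable borel" if "i \<in> I" for i
    unfolding F_def using that by measurable
  have Gm [measurable]: "G i \<in> borel_measurable borel" for i unfolding G_def by measurable
  have Fb: "norm (F i x) \<le> E i * norm (kD x)" if "i \<in> I" for i x
    using bound[OF that, of x] by (auto simp: F_def kD_def norm_mult indicator_def mult_right_mono)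
  \<comment> \<open>\<open>F\<close> and \<open>G\<close> differ by a translation in each slice; integrating \<open>F\<close> over \<open>I\<close> first gives the
    right-hand side and integrating \<open>G\<close> over \<open>I\<close> first gives \<open>g\<close>.\<close>
  have FG: "AE x in lborel. G i (x + t i) = F i x" if "i \<in> I" for i
    using quasi[OF that] by eventually_elim (auto simp: F_def G_def kD_def indicator_def)
  have shift: "integral\<^sup>L lborel f = (\<integral>x. f (x + c) \<partial>lborel)"
    if "f \<in> borel_measurable borel"
    for f :: "'a \<Rightarrow> 'c::{banach, second_countable_topology}" and c
    using that integral_distr[of "(+) c" lborel borel f] by (simp add: lborel_distr_plus add.commute)
  have nshift: "integral\<^sup>N lborel f = (\<integral>\<^sup>+x. f (x + c) \<partial>lborel)"
    if "f \<in> borel_measurable borel" for f c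
    using that nn_integral_distr[of "(+) c" lborel borel f] by (simp add: lborel_distr_plus add.commute)
  have nFG: "(\<integral>\<^sup>+x. norm (G i x) \<partial>lborel) = (\<integral>\<^sup>+x. norm (F i x) \<partial>lborel)" if "i \<in> I" for i
    by (subst nshift[of _ "t i"], simp) (rule nn_integral_cong_AE, use FG[OF that] in eventually_elim, simp)
  \<comment> \<open>Joint measurability follows from measurability of each slice because the index
    set is countable.\<close>
  have Fmp [measurable]: "case_prod F \<in> borel_measurable ?P"
    using I by (rule measurable_pair_measure_countable1) auto
  have Gmp [measurable]: "case_prod G \<in> borel_measurable ?P"
    using I by (rule measurable_pair_measure_countable1) auto
  \<comment> \<open>\<open>norm (E i)\<close> replaces \<open>E i\<close>, whose sign is unknown
    when \<open>D\<close> is empty.\<close>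
  have fin: "(\<integral>\<^sup>+i. \<integral>\<^sup>+x. norm (F i x) \<partial>lborel \<partial>count_space I) < \<infinity>"
  proof -
    have "(\<integral>\<^sup>+i. \<integral>\<^sup>+x. norm (F i x) \<partial>lborel \<partial>count_space I)
        \<le> (\<integral>\<^sup>+i. norm (E i) * (\<integral>\<^sup>+x. norm (kD x) \<partial>lborel) \<partial>count_space I)"
    proof (rule nn_integral_mono)
      fix i assume "i \<in> space (count_space I)"
      then have i: "i \<in> I" by simp
      have "(\<integral>\<^sup>+x. norm (F i x) \<partial>lborel) \<le> (\<integral>\<^sup>+x. norm (E i) * ennreal (norm (kD x)) \<partial>lborel)"
        using order_trans[OF Fb[OF i] mult_right_mono[OF abs_ge_self norm_ge_zero]]
        by (intro nn_integral_mono) (simp add: ennreal_leI flip: ennreal_mult)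
      then show "(\<integral>\<^sup>+x. norm (F i x) \<partial>lborel) \<le> norm (E i) * (\<integral>\<^sup>+x. norm (kD x) \<partial>lborel)"
        by (simp add: nn_integral_cmult)
    qed
    also have "\<dots> = (\<integral>\<^sup>+i. norm (E i) \<partial>count_space I) * (\<integral>\<^sup>+x. norm (kD x) \<partial>lborel)"
      by (rule nn_integral_multc) simp
    also have "\<dots> < \<infinity>"
      using E kD by (simp add: integrable_iff_bounded ennreal_mult_less_top)
    finally show ?thesis .
  qed
  have Fi: "integrable ?P (case_prod F)"
  proof (rule integrableI_bounded)
    show "(\<integral>\<^sup>+p. ennreal (norm (case_prod F p)) \<partial>?P) < \<infinity>"
      using fin by (subst lborel.nn_integral_fst[symmetric]) (auto simp: case_prod_beta)
  qed simp
  have Gi: "integrable ?P (case_prod G)"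
  proof (rule integrableI_bounded)
    have "(\<integral>\<^sup>+i. \<integral>\<^sup>+x. norm (G i x) \<partial>lborel \<partial>count_space I)
        = (\<integral>\<^sup>+i. \<integral>\<^sup>+x. norm (F i x) \<partial>lborel \<partial>count_space I)"
      by (rule nn_integral_cong) (simp add: nFG)
    then show "(\<integral>\<^sup>+p. ennreal (norm (case_prod G p)) \<partial>?P) < \<infinity>"
      using fin by (subst lborel.nn_integral_fst[symmetric]) (auto simp: case_prod_beta)
  qed simp
  \<comment> \<open>Summability of the factors is known only on \<open>D\<close>; off
    \<open>D\<close> both sides vanish.\<close>
  have sumF: "(\<integral>i. F i x \<partial>count_space I) = indicator D x *\<^sub>R ((\<Sum>\<^sub>\<infinity>i\<in>I. e i x) * k x)" for x
  proof (cases "x \<in> D")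
    case True
    have "integrable (count_space I) (\<lambda>i. e i x)"
      by (rule Bochner_Integration.integrable_bound[OF E])
        (use bound[OF _ True] in \<open>auto simp: AE_count_space intro: order_trans[OF _ abs_ge_self]\<close>)
    then show ?thesis using True by (simp add: F_def kD_def infsum_eq_integral_count_space)
  qed (simp add: F_def kD_def)
  \<comment> \<open>Almost every point lies in exactly one tile, so a single term survives.\<close>
  have sumG: "AE y in lborel. (\<integral>i. G i y \<partial>count_space I) = g y"
    using tiling
  proof eventually_elim
    fix y assume "\<exists>!i. i \<in> I \<and> y - t i \<in> D"
    then obtain j where j: "j \<in> I \<and> y - t j \<in> D" and u: "\<forall>i. i \<in> I \<and> y - t i \<in> D \<longrightarrow> i = j"
      by (rule ex1E)
    have "(\<integral>i. G i y \<partial>count_space I) = (\<integral>i. indicator {j} i *\<^sub>R g y \<partial>count_space I)"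
    proof (rule Bochner_Integration.integral_cong[OF refl])
      fix i assume "i \<in> space (count_space I)"
      then have "y - t i \<in> D \<longleftrightarrow> i = j" using j u by (metis space_count_space)
      then show "G i y = indicator {j} i *\<^sub>R g y" unfolding G_def indicator_def by simp
    qed
    also have "\<dots> = g y"
      by (subst integral_scaleR_left) (use j in \<open>simp_all add: integrable_real_indicator\<close>)
    finally show "(\<integral>i. G i y \<partial>count_space I) = g y" .
  qed
  have m: "(\<lambda>y. \<integral>i. G i y \<partial>count_space I) \<in> borel_measurable lborel"
    using P.integrable_snd[OF Gi] by simp
  show gi: "integrable lborel g"
    using P.integrable_snd[OF Gi] sumG m by (subst integrable_cong_AE[OF _ m]) auto
  show "set_integrable lborel D (\<lambda>x. (\<Sum>\<^sub>\<infinity>i\<in>I. e i x) * k x)"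
    using P.integrable_snd[OF Fi] by (simp add: set_integrable_def sumF)
  have "integral\<^sup>L lborel g = (\<integral>y. \<integral>i. G i y \<partial>count_space I \<partial>lborel)"
    by (rule integral_cong_AE) (use sumG m in auto)
  also have "\<dots> = (\<integral>i. \<integral>y. G i y \<partial>lborel \<partial>count_space I)" by (rule P.Fubini_integral[OF Gi])
  also have "\<dots> = (\<integral>i. \<integral>x. F i x \<partial>lborel \<partial>count_space I)"
  proof (rule Bochner_Integration.integral_cong)
    fix i assume "i \<in> space (count_space I)"
    then have i: "i \<in> I" by simp
    show "integral\<^sup>L lborel (G i) = integral\<^sup>L lborel (F i)"
      by (subst shift[of _ "t i"], simp) (rule integral_cong_AE, use FG[OF i] i in auto)
  qed simp
  also have "\<dots> = (\<integral>x. \<integral>i. F i x \<partial>count_space I \<partial>lborel)" by (rule P.Fubini_integral[OF Fi, symmetric])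
  also have "\<dots> = (LINT x:D|lborel. (\<Sum>\<^sub>\<infinity>i\<in>I. e i x) * k x)"
    by (simp add: set_lebesgue_integral_def sumF)
  finally show "integral\<^sup>L lborel g = (LINT x:D|lborel. (\<Sum>\<^sub>\<infinity>i\<in>I. e i x) * k x)" .
qed

section \<open>Gaussian integrals and sums\<close>

text \<open>Completing the square gives a multiple of the normal density with mean
  \<open>a / (2 * \<nu>)\<close> and variance \<open>1 / (2 * \<nu>)\<close>.\<close>

lemma integrable_exp_neg_square_plus_linear:
  fixes \<nu> a :: real
  assumes "\<nu> > 0"
  shows "integrable lborel (\<lambda>t. exp (a * t - \<nu> * t\<^sup>2))"
proof -
  define \<sigma> where "\<sigma> = sqrt (1 / (2 * \<nu>))"
  define \<mu> where "\<mu> = a / (2 * \<nu>)"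
  have s: "\<sigma> > 0" "\<sigma>\<^sup>2 = 1 / (2 * \<nu>)" using assms by (auto simp: \<sigma>_def)
  have "a * t - \<nu> * t\<^sup>2 = a\<^sup>2 / (4 * \<nu>) + - (t - \<mu>)\<^sup>2 / (2 * \<sigma>\<^sup>2)" for t
    unfolding s(2) \<mu>_def using assms by (simp add: power2_eq_square field_simps)
  then have "exp (a * t - \<nu> * t\<^sup>2)
      = exp (a\<^sup>2 / (4 * \<nu>)) * sqrt (2 * pi * \<sigma>\<^sup>2) * normal_density \<mu> \<sigma> t" for t
    using s(1) by (simp add: normal_density_def flip: exp_add)
  then show ?thesis using integrable_normal_density[OF s(1)] by simp
qed

text \<open>The integrand is a product over the orthonormal basis, so Tonelli reduces it to one
  variable.\<close>

lemma integrable_gaussian_linear: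
  fixes a :: "'a::euclidean_space"
  assumes "\<nu> > 0"
  shows "integrable lborel (\<lambda>x. exp (a \<bullet> x - \<nu> * (norm x)\<^sup>2))"
proof (rule integrableI_bounded)
  have "(norm x)\<^sup>2 = (\<Sum>b\<in>Basis. (x \<bullet> b)\<^sup>2)" for x :: 'a
    by (subst power2_norm_eq_inner, subst euclidean_inner) (simp add: power2_eq_square)
  then have "exp (a \<bullet> x - \<nu> * (norm x)\<^sup>2) = (\<Prod>b\<in>Basis. exp ((a \<bullet> b) * (x \<bullet> b) - \<nu> * (x \<bullet> b)\<^sup>2))" for x
    by (simp add: euclidean_inner[of a x] sum_subtractf sum_distrib_left flip: exp_sum)
  then have "(\<integral>\<^sup>+x. ennreal (norm (exp (a \<bullet> x - \<nu> * (norm x)\<^sup>2))) \<partial>lborel)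
      = (\<integral>\<^sup>+x. (\<Prod>b\<in>Basis. ennreal (exp ((a \<bullet> b) * (x \<bullet> b) - \<nu> * (x \<bullet> b)\<^sup>2))) \<partial>lborel)"
    by (simp add: prod_ennreal abs_prod)
  also have "\<dots> = (\<Prod>b\<in>Basis. (\<integral>\<^sup>+t. ennreal (exp ((a \<bullet> b) * t - \<nu> * t\<^sup>2)) \<partial>lborel))"
    by (rule nn_integral_lborel_prod) auto
  also have "\<dots> < \<infinity>"
    using integrable_exp_neg_square_plus_linear[OF assms]
    by (simp add: integrable_iff_bounded infinity_ennreal_def ennreal_prod_eq_top flip: less_top)
  finally show "(\<integral>\<^sup>+x. ennreal (norm (exp (a \<bullet> x - \<nu> * (norm x)\<^sup>2))) \<partial>lborel) < \<infinity>" .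
qed simp

text \<open>Both half-lines give a geometric series of ratio \<open>exp (-1)\<close>; that they
  share 0 does not harm absolute summability on the union.\<close>

lemma integrable_exp_neg_abs_int: "integrable (count_space UNIV) (\<lambda>n::int. exp (- real_of_int \<bar>n\<bar>))"
proof -
  have "summable (\<lambda>n::nat. norm (exp (- real n)))"
    using summable_geometric[of "exp (-1) :: real"] by (simp flip: exp_of_nat_mult)
  then have "Infinite_Set_Sum.abs_summable_on (\<lambda>n::nat. exp (- real n)) UNIV"
    by (simp add: abs_summable_on_nat_iff')
  then have "Infinite_Set_Sum.abs_summable_on (\<lambda>n. exp (- real_of_int \<bar>n\<bar>)) (range int)"
      "Infinite_Set_Sum.abs_summable_on (\<lambda>n. exp (- real_of_int \<bar>n\<bar>)) (range (\<lambda>n. - int n))"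
    by (auto intro!: abs_summable_on_reindex)
  moreover have "range int \<union> range (\<lambda>n. - int n) = UNIV"
    by (auto simp: image_iff) (metis int_cases2)
  ultimately show ?thesis
    by (metis abs_summable_on_union abs_summable_on_def)
qed

text \<open>The exponential factors over the coordinates. For empty \<open>A\<close>, the case of
  rank 0, the index set is a single point.\<close>

lemma integrable_exp_neg_l1_int:
  assumes "finite A"
  shows "integrable (count_space (A \<rightarrow>\<^sub>E UNIV)) (\<lambda>n. exp (- (\<Sum>i\<in>A. real_of_int \<bar>n i\<bar>)))"
  using abs_summable_on_prod_PiE[OF assms, of "\<lambda>_. UNIV" "\<lambda>_ n. exp (- real_of_int \<bar>n\<bar>)"]
    integrable_exp_neg_abs_int assms
  by (simp add: abs_summable_on_def exp_sum flip: sum_negf)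

section \<open>Coordinates and orthogonal components\<close>

text \<open>The functionals dual to the basis extend linearly to the whole space and are bounded
  there. This serves twice: it makes the integer coordinates of a lattice point unique, and it turns
  decay in the norm of a lattice point into decay in its coordinates.\<close>

lemma sum_abs_coords_le_norm:
  fixes \<omega> :: "nat \<Rightarrow> 'a::euclidean_space"
  assumes "inj_on \<omega> {..<r}" and "independent (\<omega> ` {..<r})"
  shows "\<exists>K. \<forall>n. (\<Sum>i<r. \<bar>n i\<bar>) \<le> K * norm (\<Sum>i<r. n i *\<^sub>R \<omega> i)"
proof -
  have "\<exists>C. \<forall>n. \<bar>n i\<bar> \<le> C * norm (\<Sum>j<r. n j *\<^sub>R \<omega> j)" if "i < r" for i
  proof -
    obtain g :: "'a \<Rightarrow> real" where g: "linear g" "\<And>b. b \<in> \<omega> ` {..<r} \<Longrightarrow> g b = (if b = \<omega> i then 1 else 0)"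
      using linear_independent_extend[OF assms(2), of "\<lambda>b. if b = \<omega> i then 1 else 0 :: real"] by blast
    have "g (\<Sum>j<r. n j *\<^sub>R \<omega> j) = (\<Sum>j<r. if j = i then n j else 0)" for n
      unfolding linear_sum[OF g(1)] linear_cmul[OF g(1)]
      using g(2) inj_on_eq_iff[OF assms(1)] that by (intro sum.cong) auto
    then have "g (\<Sum>j<r. n j *\<^sub>R \<omega> j) = n i" for n using that by simp
    moreover obtain C where "\<And>x. norm (g x) \<le> norm x * C"
      using bounded_linear.bounded g(1) linear_conv_bounded_linear by blast
    ultimately show ?thesis by (metis mult.commute real_norm_def)
  qed
  then obtain C where C: "\<And>i n. i < r \<Longrightarrow> \<bar>n i\<bar> \<le> C i * norm (\<Sum>j<r. n j *\<^sub>R \<omega> j)" by metis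
  show ?thesis
  proof (intro exI allI)
    fix n
    let ?s = "norm (\<Sum>j<r. n j *\<^sub>R \<omega> j)"
    have "(\<Sum>i<r. \<bar>n i\<bar>) \<le> (\<Sum>i<r. \<bar>C i\<bar> * ?s)"
      using C by (intro sum_mono) (meson abs_ge_self lessThan_iff mult_right_mono norm_ge_zero order_trans)
    then show "(\<Sum>i<r. \<bar>n i\<bar>) \<le> (\<Sum>i<r. \<bar>C i\<bar>) * ?s" by (simp add: sum_distrib_right)
  qed
qed

text \<open>Two candidates differ by an element of \<open>V \<inter> W\<close>. Asking only for
  closure under differences lets the lemma cover both real subspaces and their
  complexifications.\<close>

lemma summand_eq:
  assumes "y \<in> V" and "x - y \<in> W"
    and "\<And>a b. a \<in> V \<Longrightarrow> b \<in> V \<Longrightarrow> a - b \<in> V" and "\<And>a b. a \<in> W \<Longrightarrow> b \<in> W \<Longrightarrow> a - b \<in> W"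
    and "V \<inter> W \<subseteq> {0}"
  shows "summand V W x = y"
  unfolding summand_def
proof (rule the_equality)
  fix y' assume y': "y' \<in> V \<and> x - y' \<in> W"
  then have "y' - y \<in> V" using assms by blast
  moreover have "y' - y \<in> W" using assms(4)[OF assms(2), of "x - y'"] y' by simp
  ultimately show "y' = y" using assms(5) by auto
qed (use assms in simp)

lemma inner_orthogonal_comp:
  "x \<in> V \<Longrightarrow> y \<in> V\<^sup>\<bottom> \<Longrightarrow> x \<bullet> y = 0"
  by (auto simp: orthogonal_comp_def orthogonal_def)

lemma subspace_Int_orthogonal_comp_subset: "V \<inter> V\<^sup>\<bottom> \<subseteq> {0}"
  using inner_orthogonal_comp by force

lemma orthogonal_decomp:
  fixes B :: "'a::euclidean_space set"
  obtains y where "y \<in> span B" and "x - y \<in> (span B)\<^sup>\<bottom>"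
proof -
  obtain y z where "y \<in> span B" and "\<And>w. w \<in> span B \<Longrightarrow> orthogonal z w" and "x = y + z"
    by (metis orthogonal_subspace_decomp_exists[of B x])
  then show thesis using that[of y] by (auto simp: orthogonal_comp_def orthogonal_commute)
qed

section \<open>Complexification and the bilinear form\<close>

lemma cvec_add: "cvec (x + y) = cvec x + cvec y"
  and cvec_diff: "cvec (x - y) = cvec x - cvec y"
  and cvec_scaleR: "cvec (c *\<^sub>R x) = complex_of_real c *s cvec x"
  and cvec_0: "cvec 0 = 0"
  by (simp_all add: cvec_def vec_eq_iff)

lemma cvec_sum: "cvec (\<Sum>i\<in>A. f i) = (\<Sum>i\<in>A. cvec (f i))"
  by (simp add: cvec_def vec_eq_iff)

lemma cvec_complex_eq_iff:
  "cvec x + \<i> *s cvec y = cvec x' + \<i> *s cvec y' \<longleftrightarrow> x = x' \<and> y = y'"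
  by (auto simp: cvec_def vec_eq_iff complex_eq_iff)

lemma cvec_Re_Im: "z = cvec (\<chi> j. Re (z $ j)) + \<i> *s cvec (\<chi> j. Im (z $ j))"
  by (auto simp: cvec_def vec_eq_iff complex_eq_iff)

lemma inj_cvec: "inj cvec"
  by (auto simp: inj_def cvec_def vec_eq_iff)

lemma complexifyI: "x \<in> V \<Longrightarrow> y \<in> V \<Longrightarrow> cvec x + \<i> *s cvec y \<in> complexify V"
  by (auto simp: complexify_def)

lemma complexify_diff:
  assumes "subspace V" and "a \<in> complexify V" and "b \<in> complexify V"
  shows "a - b \<in> complexify V"
proof -
  obtain x y x' y' where "a = cvec x + \<i> *s cvec y" "b = cvec x' + \<i> *s cvec y'"
    and V: "x \<in> V" "y \<in> V" "x' \<in> V" "y' \<in> V"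
    using assms(2,3) by (auto simp: complexify_def)
  then have "a - b = cvec (x - x') + \<i> *s cvec (y - y')"
    by (simp add: cvec_diff vec.scale_right_diff_distrib)
  then show ?thesis using V assms(1) by (simp add: complexifyI subspace_diff)
qed

lemma complexify_Int_subset:
  assumes "V \<inter> W \<subseteq> {0}"
  shows "complexify V \<inter> complexify W \<subseteq> {0}"
proof -
  have "cvec x + \<i> *s cvec y = 0" if "x \<in> V" "y \<in> V" "x \<in> W" "y \<in> W" for x y
    using assms that by (metis IntI add_0 cvec_0 singletonD subsetD vec.scale_zero_right)
  then show ?thesis by (auto simp: complexify_def cvec_complex_eq_iff)
qed

text \<open>The vectors whose image under \<open>cvec\<close> lies in the complex span form a real
  subspace containing \<open>B\<close>.\<close>

lemma complexify_span_subset: "complexify (span B) \<subseteq> vec.span (cvec ` B)"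
proof -
  have "cvec x \<in> vec.span (cvec ` B)" if "x \<in> span B" for x
    using that
  proof (induction rule: span_induct)
    case base
    show ?case
      by (auto simp: subspace_def cvec_0 cvec_add cvec_scaleR intro: vec.span_zero vec.span_add vec.span_scale)
  next
    case (step x)
    then show ?case by (auto intro: vec.span_base)
  qed
  then show ?thesis by (auto simp: complexify_def intro: vec.span_add vec.span_scale)
qed

text \<open>A complex relation between real vectors splits into two real ones, for the real and the
  imaginary parts of the coefficients.\<close>

lemma independent_cvec:
  assumes "independent B"
  shows "vec.independent (cvec ` B)"
proof (rule vec.independent_if_scalars_zero)
  have fin: "finite B" by (rule independent_imp_finite[OF assms])
  then show "finite (cvec ` B)" by simp
  fix f w assume "(\<Sum>x\<in>cvec ` B. f x *s x) = 0" and "w \<in> cvec ` B"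
  then have s: "(\<Sum>b\<in>B. f (cvec b) *s cvec b) = 0" and w: "\<exists>b\<in>B. w = cvec b"
    using inj_on_subset[OF inj_cvec subset_UNIV, of B] by (auto simp: sum.reindex)
  have "(\<Sum>b\<in>B. Re (f (cvec b)) *\<^sub>R b) = 0" "(\<Sum>b\<in>B. Im (f (cvec b)) *\<^sub>R b) = 0"
    using s by (auto simp: vec_eq_iff complex_eq_iff cvec_def)
  then have "Re (f (cvec b)) = 0" "Im (f (cvec b)) = 0" if "b \<in> B" for b
    using independentD[OF assms fin order_refl _ that, of "\<lambda>b. Re (f (cvec b))"]
      independentD[OF assms fin order_refl _ that, of "\<lambda>b. Im (f (cvec b))"] by auto
  then show "f w = 0" using w by (auto simp: complex_eq_iff)
qed

lemma cdot_cvec: "cdot (cvec x + \<i> *s cvec y) (cvec u) = Complex (x \<bullet> u) (y \<bullet> u)"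
  by (simp add: cdot_def cvec_def inner_vec_def complex_eq_iff)

lemma cdot_diff_left: "cdot (z - w) u = cdot z u - cdot w u"
  and cdot_sum_left: "cdot (\<Sum>i\<in>A. f i) u = (\<Sum>i\<in>A. cdot (f i) u)"
  and cdot_scale_left: "cdot (c *s z) u = c * cdot z u"
proof -
  show "cdot (\<Sum>i\<in>A. f i) u = (\<Sum>i\<in>A. cdot (f i) u)"
    unfolding cdot_def by (simp add: sum_distrib_right) (rule sum.swap)
qed (simp_all add: cdot_def sum_subtractf left_diff_distrib sum_distrib_left mult.assoc)

lemma cdot_add_right: "cdot z (u + w) = cdot z u + cdot z w"
  and cdot_scale_right: "cdot z (c *s u) = c * cdot z u"
  by (simp_all add: cdot_def distrib_left sum.distrib sum_distrib_left mult.left_commute)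

lemma cdot_sum_right: "cdot z (\<Sum>i\<in>A. f i) = (\<Sum>i\<in>A. cdot z (f i))"
  unfolding cdot_def by (simp add: sum_distrib_left) (rule sum.swap)

text \<open>Multiplying by the Gram matrix turns the coordinates of the projection of
  \<open>x\<close> into scalar products, and the orthogonal component drops out. The theta function
  sees the coordinates only through this product, so the matrix is never inverted.\<close>

lemma sum_gram_real_coords:
  fixes \<omega> :: "nat \<Rightarrow> real ^ 'd"
  assumes inj: "inj_on \<omega> {..<r}" and indep: "independent (\<omega> ` {..<r})" and i: "i < r"
  shows "(\<Sum>j<r. gram \<omega> i j * real_coords r \<omega> x j) = \<omega> i \<bullet> x"
proof -
  let ?B = "\<omega> ` {..<r}"
  obtain y where y: "y \<in> span ?B" "x - y \<in> (span ?B)\<^sup>\<bottom>" by (rule orthogonal_decomp)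
  then have s: "summand (span ?B) ((span ?B)\<^sup>\<bottom>) x = y"
    by (intro summand_eq subspace_Int_orthogonal_comp_subset)
      (auto intro: span_diff subspace_diff subspace_orthogonal_comp)
  have "(\<Sum>j<r. real_coords r \<omega> x j *\<^sub>R \<omega> j) = (\<Sum>b\<in>?B. representation ?B y b *\<^sub>R b)"
    by (simp add: real_coords_def s sum.reindex[OF inj])
  also have "\<dots> = y" by (rule sum_representation_eq) (use indep y in auto)
  finally have "(\<Sum>j<r. gram \<omega> i j * real_coords r \<omega> x j) = \<omega> i \<bullet> y"
    by (auto simp: gram_def inner_sum_right mult.commute)
  moreover have "\<omega> i \<bullet> (x - y) = 0"
    using i by (intro inner_orthogonal_comp[OF _ y(2)]) (auto intro: span_base)
  ultimately show ?thesis by (simp add: inner_diff_right)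
qed

lemma sum_gram_complex_coords:
  fixes \<omega> :: "nat \<Rightarrow> real ^ 'd"
  assumes inj: "inj_on \<omega> {..<r}" and indep: "independent (\<omega> ` {..<r})" and i: "i < r"
  shows "(\<Sum>j<r. complex_of_real (gram \<omega> i j) * complex_coords r \<omega> z j) = cdot z (cvec (\<omega> i))"
proof -
  let ?B = "\<omega> ` {..<r}"
  let ?V = "span ?B"
  define x where "x = (\<chi> j. Re (z $ j))"
  define y where "y = (\<chi> j. Im (z $ j))"
  have z: "z = cvec x + \<i> *s cvec y" unfolding x_def y_def by (rule cvec_Re_Im)
  \<comment> \<open>The complex decomposition comes from projecting the real and the imaginary part
    separately.\<close>
  obtain x1 where x1: "x1 \<in> ?V" "x - x1 \<in> ?V\<^sup>\<bottom>" by (rule orthogonal_decomp)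
  obtain y1 where y1: "y1 \<in> ?V" "y - y1 \<in> ?V\<^sup>\<bottom>" by (rule orthogonal_decomp)
  define z1 where "z1 = cvec x1 + \<i> *s cvec y1"
  have zz: "z - z1 = cvec (x - x1) + \<i> *s cvec (y - y1)"
    by (simp add: z z1_def cvec_diff vec.scale_right_diff_distrib)
  have z1: "z1 \<in> complexify ?V" unfolding z1_def using x1 y1 by (simp add: complexifyI)
  then have s: "summand (complexify ?V) (complexify (?V\<^sup>\<bottom>)) z = z1"
    using x1 y1 by (intro summand_eq complexify_Int_subset subspace_Int_orthogonal_comp_subset)
      (auto simp: zz intro: complexifyI complexify_diff subspace_span subspace_orthogonal_comp)
  have inj': "inj_on (\<lambda>j. cvec (\<omega> j)) {..<r}"
    using comp_inj_on[OF inj inj_on_subset[OF inj_cvec subset_UNIV]] by (simp add: o_def)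
  have im: "cvec ` ?B = (\<lambda>j. cvec (\<omega> j)) ` {..<r}" by auto
  have "(\<Sum>j<r. complex_coords r \<omega> z j *s cvec (\<omega> j))
      = (\<Sum>b\<in>cvec ` ?B. vec.representation (cvec ` ?B) z1 b *s b)"
    unfolding im sum.reindex[OF inj'] by (simp add: complex_coords_def s image_image)
  also have "\<dots> = z1"
    by (rule vec.sum_representation_eq)
      (use independent_cvec[OF indep] z1 complexify_span_subset in auto)
  finally have "cdot z1 (cvec (\<omega> i)) = (\<Sum>j<r. complex_coords r \<omega> z j * cdot (cvec (\<omega> j)) (cvec (\<omega> i)))"
    by (auto simp: cdot_sum_left cdot_scale_left)
  moreover have "cdot (cvec (\<omega> j)) (cvec (\<omega> i)) = complex_of_real (gram \<omega> i j)" for j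
    using cdot_cvec[of "\<omega> j" 0 "\<omega> i"] by (simp add: cvec_0 gram_def inner_commute complex_eq_iff)
  moreover have "cdot (z - z1) (cvec (\<omega> i)) = 0"
    unfolding zz cdot_cvec using i inner_orthogonal_comp[of "\<omega> i" ?V] x1 y1
    by (auto simp: complex_eq_iff inner_commute[of _ "\<omega> i"] span_base)
  ultimately show ?thesis by (simp add: cdot_diff_left mult.commute)
qed

section \<open>Translates of the fundamental domain\<close>

text \<open>A compact set plus a closed one is closed; this makes the fundamental domain
  Borel.\<close>

lemma closed_cylinder: "compact D \<Longrightarrow> closed (cylinder V D)"
proof -
  assume "compact D"
  then have "closed (\<Union>x\<in>D. \<Union>y\<in>V\<^sup>\<bottom>. {x + y})"
    by (rule compact_closed_sums) (simp add: closed_subspace subspace_orthogonal_comp)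
  also have "(\<Union>x\<in>D. \<Union>y\<in>V\<^sup>\<bottom>. {x + y}) = cylinder V D"
    by (auto simp: cylinder_def)
  finally show ?thesis .
qed

lemma mem_cylinder_iff: "x \<in> cylinder V D \<longleftrightarrow> (\<exists>a\<in>D. x - a \<in> V\<^sup>\<bottom>)"
proof
  assume "\<exists>a\<in>D. x - a \<in> V\<^sup>\<bottom>"
  then obtain a where "a \<in> D" "x - a \<in> V\<^sup>\<bottom>" by blast
  moreover have "x = a + (x - a)" by simp
  ultimately show "x \<in> cylinder V D" unfolding cylinder_def by blast
qed (force simp: cylinder_def)

lemma mem_cylinder_translate: "x - c \<in> cylinder V D \<longleftrightarrow> x \<in> cylinder V ((+) c ` D)"
  by (simp add: mem_cylinder_iff diff_diff_eq)

text \<open>The component in \<open>V\<close> of a point is unique. The fundamental domain condition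
  speaks of overlaps inside \<open>V\<close>; this converts them into overlaps of translated
  cylinders.\<close>

lemma cylinder_Int:
  assumes "subspace V" and "A \<subseteq> V" and "B \<subseteq> V"
  shows "cylinder V A \<inter> cylinder V B = cylinder V (A \<inter> B)"
proof -
  have "a = b" if "a \<in> A" "b \<in> B" "x - a \<in> V\<^sup>\<bottom>" "x - b \<in> V\<^sup>\<bottom>" for a b x
  proof -
    have "a - b \<in> V" using that assms by (auto intro: subspace_diff)
    moreover have "a - b \<in> V\<^sup>\<bottom>"
      using subspace_diff[OF subspace_orthogonal_comp that(4,3)] by simp
    ultimately show ?thesis using subspace_Int_orthogonal_comp_subset[of V] by auto
  qed
  then show ?thesis by (fastforce simp: mem_cylinder_iff)
qed

lemma AE_lborel_notin_negligible:
  assumes "negligible N"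
  shows "AE x in lborel. x \<notin> N"
  using AE_not_in[of N lebesgue] assms by (simp add: negligible_iff_null_sets AE_completion_iff)

text \<open>Existence holds everywhere, by covering the component in \<open>V\<close>. Uniqueness
  fails only on countably many pairwise overlaps, each of them null.\<close>

lemma AE_unique_translate:
  assumes fd: "compact_fundamental_domain \<Gamma> V D" and V: "subspace V"
    and t: "bij_betw t I \<Gamma>" and I: "countable I"
  shows "AE x in lborel. \<exists>!i. i \<in> I \<and> x - t i \<in> cylinder V D"
proof -
  have cover: "(\<Union>\<gamma>\<in>\<Gamma>. (+) \<gamma> ` D) = V"
    and null: "\<And>\<gamma> \<gamma>'. \<gamma> \<in> \<Gamma> \<Longrightarrow> \<gamma>' \<in> \<Gamma> \<Longrightarrow> \<gamma> \<noteq> \<gamma>' \<Longrightarrow>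
        negligible (cylinder V ((+) \<gamma> ` D \<inter> (+) \<gamma>' ` D))"
    using fd by (auto simp: compact_fundamental_domain_def)
  have tI: "t i \<in> \<Gamma>" if "i \<in> I" for i using t that by (auto simp: bij_betw_def)
  have ex: "\<exists>i. i \<in> I \<and> x - t i \<in> cylinder V D" for x
  proof -
    obtain y where y: "y \<in> V" "x - y \<in> V\<^sup>\<bottom>"
      using orthogonal_decomp[of V x] V by (metis span_eq_iff)
    then obtain \<gamma> where "\<gamma> \<in> \<Gamma>" "y \<in> (+) \<gamma> ` D" using cover by blast
    then have "\<gamma> \<in> \<Gamma>" and "x - \<gamma> \<in> cylinder V D"
      using y(2) unfolding mem_cylinder_translate mem_cylinder_iff[of x] by blast+
    then show ?thesis using t by (auto simp: bij_betw_def)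
  qed
  have "AE x in lborel. \<forall>i\<in>I. \<forall>j\<in>I. i \<noteq> j \<longrightarrow> \<not> (x - t i \<in> cylinder V D \<and> x - t j \<in> cylinder V D)"
  proof (intro AE_ball_countable' I)
    fix i j assume ij: "i \<in> I" "j \<in> I"
    show "AE x in lborel. i \<noteq> j \<longrightarrow> \<not> (x - t i \<in> cylinder V D \<and> x - t j \<in> cylinder V D)"
    proof (cases "i = j")
      case False
      then have "t i \<noteq> t j" using t ij by (auto simp: bij_betw_def inj_on_def)
      from AE_lborel_notin_negligible[OF null[OF tI[OF ij(1)] tI[OF ij(2)] this]]
      show ?thesis
      proof eventually_elim
        case (elim x)
        have "(+) (t i) ` D \<subseteq> V" "(+) (t j) ` D \<subseteq> V" using cover tI ij by blast+
        from cylinder_Int[OF V this] show ?case using elim by (auto simp: mem_cylinder_translate)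
      qed
    qed simp
  qed
  then show ?thesis
  proof eventually_elim
    case (elim x)
    then show ?case using ex[of x] by blast
  qed
qed

section \<open>Parametrisation of the lattice by integer vectors\<close>

definition lattice_point :: "nat \<Rightarrow> (nat \<Rightarrow> real ^ 'd) \<Rightarrow> (nat \<Rightarrow> int) \<Rightarrow> real ^ 'd" where
  "lattice_point r \<omega> n = (\<Sum>i<r. of_int (n i) *\<^sub>R \<omega> i)"

text \<open>Injectivity applies the coordinate bound to the difference of two coefficient vectors;
  it determines them below \<open>r\<close> only, and extensionality fixes the rest.\<close>

lemma bij_betw_lattice_point:
  assumes "inj_on \<omega> {..<r}" and "independent (\<omega> ` {..<r})"
  shows "bij_betw (lattice_point r \<omega>) ({..<r} \<rightarrow>\<^sub>E UNIV) (lattice r \<omega>)"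
proof (rule bij_betw_imageI)
  obtain K where K: "(\<Sum>i<r. \<bar>n i\<bar>) \<le> K * norm (\<Sum>i<r. n i *\<^sub>R \<omega> i)" for n
    using sum_abs_coords_le_norm[OF assms] by blast
  show "inj_on (lattice_point r \<omega>) ({..<r} \<rightarrow>\<^sub>E UNIV)"
  proof (rule inj_onI)
    fix m n :: "nat \<Rightarrow> int"
    assume mn: "m \<in> {..<r} \<rightarrow>\<^sub>E UNIV" "n \<in> {..<r} \<rightarrow>\<^sub>E UNIV"
      and eq: "lattice_point r \<omega> m = lattice_point r \<omega> n"
    then have "(\<Sum>i<r. (of_int (m i) - of_int (n i)) *\<^sub>R \<omega> i) = 0"
      by (simp add: lattice_point_def scaleR_left_diff_distrib sum_subtractf)
    then have "(\<Sum>i<r. \<bar>real_of_int (m i) - of_int (n i)\<bar>) \<le> 0"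
      using K[of "\<lambda>i. of_int (m i) - of_int (n i)"] by simp
    then have "(\<Sum>i<r. \<bar>real_of_int (m i) - of_int (n i)\<bar>) = 0"
      by (simp add: sum_nonneg order_antisym)
    then have "m i = n i" if "i < r" for i
      using that by (simp add: sum_nonneg_eq_0_iff)
    then show "m = n" using mn by (auto intro: PiE_ext)
  qed
  show "lattice_point r \<omega> ` ({..<r} \<rightarrow>\<^sub>E UNIV) = lattice r \<omega>"
  proof
    show "lattice r \<omega> \<subseteq> lattice_point r \<omega> ` ({..<r} \<rightarrow>\<^sub>E UNIV)"
    proof
      fix x assume "x \<in> lattice r \<omega>"
      then obtain n where "x = lattice_point r \<omega> n" by (auto simp: lattice_def lattice_point_def)
      then have x: "x = lattice_point r \<omega> (restrict n {..<r})" by (simp add: lattice_point_def)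
      have "restrict n {..<r} \<in> {..<r} \<rightarrow>\<^sub>E UNIV" by simp
      then show "x \<in> lattice_point r \<omega> ` ({..<r} \<rightarrow>\<^sub>E UNIV)" unfolding x by (rule imageI)
    qed
    show "lattice_point r \<omega> ` ({..<r} \<rightarrow>\<^sub>E UNIV) \<subseteq> lattice r \<omega>"
      unfolding lattice_def lattice_point_def by blast
  qed
qed

section \<open>The integrand and the theta series\<close>

text \<open>The factor by which translation by \<open>\<gamma>\<close> multiplies the integrand,
  with the character value left out.\<close>

definition translation_factor ::
    "real \<Rightarrow> complex ^ 'd \<Rightarrow> real ^ 'd \<Rightarrow> real ^ 'd \<Rightarrow> complex" where
  "translation_factor \<nu> z \<gamma> x =
     exp (complex_of_real (sqrt 2 * \<nu>) * cdot z (cvec \<gamma>)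
       - complex_of_real (\<nu> * (x \<bullet> \<gamma>) + \<nu> / 2 * (norm \<gamma>)\<^sup>2))"

definition bargmann_integrand ::
    "real \<Rightarrow> (real ^ 'd \<Rightarrow> complex) \<Rightarrow> complex ^ 'd \<Rightarrow> real ^ 'd \<Rightarrow> complex" where
  "bargmann_integrand \<nu> \<phi> z x =
     bargmann_kernel \<nu> z x * \<phi> x * complex_of_real (exp (- \<nu> * (norm x)\<^sup>2))"

text \<open>The Gaussian contributes \<open>- 2 * \<nu> * (x \<bullet> \<gamma>) - \<nu> * (norm
  \<gamma>)\<^sup>2\<close> to the exponent, and the growth of \<open>\<phi>\<close> cancels exactly
  half of it.\<close>

lemma bargmann_integrand_translate:
  assumes "\<phi> (x + \<gamma>) = c * complex_of_real (exp (\<nu> * inner (x + \<gamma> /\<^sub>R 2) \<gamma>)) * \<phi> x"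
  shows "bargmann_integrand \<nu> \<phi> z (x + \<gamma>)
    = c * translation_factor \<nu> z \<gamma> x * bargmann_integrand \<nu> \<phi> z x"
proof -
  let ?K = "\<lambda>y. complex_of_real (sqrt 2 * \<nu>) * cdot z (cvec y) - complex_of_real (\<nu> / 2) * cdot z z"
  have n: "(norm (x + \<gamma>))\<^sup>2 = (norm x)\<^sup>2 + 2 * (x \<bullet> \<gamma>) + (norm \<gamma>)\<^sup>2"
    by (simp add: power2_norm_eq_inner inner_add inner_commute)
  have i: "(x + \<gamma> /\<^sub>R 2) \<bullet> \<gamma> = x \<bullet> \<gamma> + (norm \<gamma>)\<^sup>2 / 2"
    by (simp add: power2_norm_eq_inner inner_add)
  have "?K (x + \<gamma>) + complex_of_real (\<nu> * ((x + \<gamma> /\<^sub>R 2) \<bullet> \<gamma>)) + complex_of_real (- \<nu> * (norm (x + \<gamma>))\<^sup>2)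
    = (complex_of_real (sqrt 2 * \<nu>) * cdot z (cvec \<gamma>)
       - complex_of_real (\<nu> * (x \<bullet> \<gamma>) + \<nu> / 2 * (norm \<gamma>)\<^sup>2)) + ?K x + complex_of_real (- \<nu> * (norm x)\<^sup>2)"
    unfolding n i by (simp add: cvec_add cdot_add_right algebra_simps)
  then have "exp (?K (x + \<gamma>)) * complex_of_real (exp (\<nu> * ((x + \<gamma> /\<^sub>R 2) \<bullet> \<gamma>)))
        * complex_of_real (exp (- \<nu> * (norm (x + \<gamma>))\<^sup>2))
      = translation_factor \<nu> z \<gamma> x * exp (?K x) * complex_of_real (exp (- \<nu> * (norm x)\<^sup>2))"
    unfolding translation_factor_def exp_of_real[symmetric] exp_add[symmetric] by (rule arg_cong)
  then show ?thesis
    unfolding bargmann_integrand_def bargmann_kernel_def assms by (simp add: algebra_simps)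
qed

section \<open>Decay and integrability estimates\<close>

lemma norm_cdot_cvec_le: "cmod (cdot z (cvec x)) \<le> (\<Sum>j\<in>UNIV. cmod (z $ j)) * norm x"
  unfolding cdot_def sum_distrib_right
  by (rule sum_norm_le) (simp add: norm_mult cvec_def mult_left_mono component_le_norm_cart)

text \<open>The quadratic term in \<open>norm \<gamma>\<close> beats every linear one, so the decay
  rate \<open>K\<close> is arbitrary and costs only a constant. It will be taken from
  \<open>sum_abs_coords_le_norm\<close>.\<close>

lemma translation_factor_bound:
  assumes "\<nu> > 0" and "\<bar>x \<bullet> \<gamma>\<bar> \<le> M * norm \<gamma>"
  shows "cmod (translation_factor \<nu> z \<gamma> x)
    \<le> exp ((sqrt 2 * \<nu> * (\<Sum>j\<in>UNIV. cmod (z $ j)) + \<nu> * M + K)\<^sup>2 / (2 * \<nu>)) * exp (- (K * norm \<gamma>))"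
proof -
  let ?L = "\<Sum>j\<in>UNIV. cmod (z $ j)"
  define b where "b = sqrt 2 * \<nu> * ?L + \<nu> * M + K"
  have "Re (cdot z (cvec \<gamma>)) \<le> ?L * norm \<gamma>"
    using complex_Re_le_cmod norm_cdot_cvec_le by (rule order_trans)
  then have "sqrt 2 * \<nu> * Re (cdot z (cvec \<gamma>)) \<le> sqrt 2 * \<nu> * (?L * norm \<gamma>)"
    using assms(1) by (intro mult_left_mono) auto
  moreover have "- (\<nu> * (x \<bullet> \<gamma>)) \<le> \<nu> * (M * norm \<gamma>)"
    using assms mult_left_mono[of "- (x \<bullet> \<gamma>)" "M * norm \<gamma>" \<nu>] by simp
  \<comment> \<open>The right-hand side is the maximum of this concave quadratic. Since
    \<open>b\<close> contains \<open>K\<close>, moving that term across leaves the decay.\<close>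
  moreover have "b * norm \<gamma> - \<nu> / 2 * (norm \<gamma>)\<^sup>2 \<le> b\<^sup>2 / (2 * \<nu>)"
  proof -
    have "b\<^sup>2 / (2 * \<nu>) - (b * norm \<gamma> - \<nu> / 2 * (norm \<gamma>)\<^sup>2) = (b - \<nu> * norm \<gamma>)\<^sup>2 / (2 * \<nu>)"
      using assms(1) by (simp add: power2_eq_square field_simps)
    also have "\<dots> \<ge> 0" using assms(1) by simp
    finally show ?thesis by simp
  qed
  ultimately have "Re (complex_of_real (sqrt 2 * \<nu>) * cdot z (cvec \<gamma>)
       - complex_of_real (\<nu> * (x \<bullet> \<gamma>) + \<nu> / 2 * (norm \<gamma>)\<^sup>2)) \<le> b\<^sup>2 / (2 * \<nu>) + - (K * norm \<gamma>)"
    by (simp add: b_def algebra_simps)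
  then show ?thesis unfolding translation_factor_def norm_exp_eq_Re exp_add[symmetric] b_def by simp
qed

lemma bargmann_kernel_measurable [measurable]: "bargmann_kernel \<nu> z \<in> borel_measurable borel"
  unfolding bargmann_kernel_def[abs_def] cdot_def cvec_def
  by (intro borel_measurable_continuous_onI) (auto intro!: continuous_intros)

text \<open>The squared modulus of the kernel has an exponent that is affine in \<open>x\<close>,
  which the Gaussian absorbs.\<close>

lemma integrable_bargmann_kernel_square:
  fixes z :: "complex ^ 'd"
  assumes "\<nu> > 0"
  shows "integrable lborel (\<lambda>x. (cmod (bargmann_kernel \<nu> z x))\<^sup>2 * exp (- \<nu> * (norm x)\<^sup>2))"
proof -
  define a where "a = (\<chi> j. Re (z $ j))"
  define q where "q = Re (cdot z z)"
  have Re: "Re (cdot z (cvec x)) = a \<bullet> x" for x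
    by (simp add: cdot_def cvec_def a_def inner_vec_def)
  have "(cmod (bargmann_kernel \<nu> z x))\<^sup>2 * exp (- \<nu> * (norm x)\<^sup>2)
      = exp (- \<nu> * q) * exp ((2 * sqrt 2 * \<nu>) *\<^sub>R a \<bullet> x - \<nu> * (norm x)\<^sup>2)" for x
    unfolding bargmann_kernel_def norm_exp_eq_Re exp_double[symmetric] exp_add[symmetric]
    by (simp add: Re q_def algebra_simps)
  then show ?thesis using integrable_gaussian_linear[OF assms, of "(2 * sqrt 2 * \<nu>) *\<^sub>R a"] by simp
qed

text \<open>The product of two functions is dominated by the sum of their squares: that of
  \<open>\<phi>\<close> is integrable on \<open>\<Lambda>\<close>, that of the kernel on the whole
  space.\<close>

lemma set_integrable_bargmann_integrand:
  fixes z :: "complex ^ 'd"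
  assumes "\<nu> > 0" and \<phi>: "\<phi> \<in> L2_space \<nu> \<Gamma> ch \<Lambda>" and [measurable]: "\<Lambda> \<in> sets borel"
  shows "set_integrable lborel \<Lambda> (bargmann_integrand \<nu> \<phi> z)"
proof -
  have [measurable]: "\<phi> \<in> borel_measurable borel"
    and fin: "(\<integral>\<^sup>+x\<in>\<Lambda>. ennreal ((cmod (\<phi> x))\<^sup>2 * exp (- \<nu> * (norm x)\<^sup>2)) \<partial>lborel) < \<infinity>"
    using \<phi> by (auto simp: L2_space_def)
  let ?p = "\<lambda>x. indicator \<Lambda> x * ((cmod (\<phi> x))\<^sup>2 * exp (- \<nu> * (norm x)\<^sup>2))"
  let ?k = "\<lambda>x. (cmod (bargmann_kernel \<nu> z x))\<^sup>2 * exp (- \<nu> * (norm x)\<^sup>2)"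
  have "integrable lborel ?p"
  proof (rule integrableI_bounded)
    have "(\<integral>\<^sup>+x. ennreal (norm (?p x)) \<partial>lborel)
        = (\<integral>\<^sup>+x\<in>\<Lambda>. ennreal ((cmod (\<phi> x))\<^sup>2 * exp (- \<nu> * (norm x)\<^sup>2)) \<partial>lborel)"
      by (intro nn_integral_cong) (auto simp: indicator_def)
    then show "(\<integral>\<^sup>+x. ennreal (norm (?p x)) \<partial>lborel) < \<infinity>" using fin by simp
  qed measurable
  then have "integrable lborel (\<lambda>x. ?p x + ?k x)"
    using integrable_bargmann_kernel_square[OF assms(1)] by (rule Bochner_Integration.integrable_add)
  then show ?thesis unfolding set_integrable_def
  proof (rule Bochner_Integration.integrable_bound)
    show "(\<lambda>x. indicator \<Lambda> x *\<^sub>R bargmann_integrand \<nu> \<phi> z x) \<in> borel_measurable lborel"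
      unfolding bargmann_integrand_def by measurable
    have amgm: "a * b * e \<le> b\<^sup>2 * e + a\<^sup>2 * e" if "e \<ge> 0" for a b e :: real
    proof -
      have "a * b \<le> b\<^sup>2 + a\<^sup>2"
        using sum_squares_bound[of a b] zero_le_power2[of a] zero_le_power2[of b] by linarith
      from mult_right_mono[OF this that] show ?thesis by (simp only: distrib_right)
    qed
    have "norm (indicator \<Lambda> x *\<^sub>R bargmann_integrand \<nu> \<phi> z x) \<le> norm (?p x + ?k x)" for x
    proof (cases "x \<in> \<Lambda>")
      case True
      have "norm (indicator \<Lambda> x *\<^sub>R bargmann_integrand \<nu> \<phi> z x)
          = cmod (bargmann_kernel \<nu> z x) * cmod (\<phi> x) * exp (- \<nu> * (norm x)\<^sup>2)"
        using True by (simp add: bargmann_integrand_def norm_mult)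
      also have "\<dots> \<le> ?p x + ?k x"
        using True amgm[OF exp_ge_zero] by simp
      also have "\<dots> \<le> norm (?p x + ?k x)" by (simp only: real_norm_def abs_ge_self)
      finally show ?thesis .
    qed simp
    then show "AE x in lborel. norm (indicator \<Lambda> x *\<^sub>R bargmann_integrand \<nu> \<phi> z x) \<le> norm (?p x + ?k x)"
      by (rule AE_I2)
  qed
qed

text \<open>The terms agree one by one, so no convergence is involved. As
  \<open>2 * \<i> * pi\<close> times \<open>\<i> * \<nu> / (2 * pi)\<close> is
  \<open>- \<nu>\<close>, the quadratic form yields the term in
  \<open>(norm \<gamma>)\<^sup>2\<close>, the argument yields those in \<open>x\<close> and
  \<open>z\<close>, and the characteristic yields the character.\<close>

lemma riemann_theta_eq_infsum:
  fixes \<omega> :: "nat \<Rightarrow> real ^ 'd"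
  assumes inj: "inj_on \<omega> {..<r}" and indep: "independent (\<omega> ` {..<r})"
    and v: "v = (\<Sum>i<r. \<beta> i *\<^sub>R \<omega> i)"
  shows "riemann_theta r (\<lambda>_. 0) (\<lambda>i. \<Sum>j<r. gram \<omega> i j * \<beta> j)
       (\<lambda>i. \<i> * complex_of_real (\<nu> / (2 * pi)) *
         (\<Sum>j<r. complex_of_real (gram \<omega> i j) *
            (complex_of_real (real_coords r \<omega> x j)
              - complex_of_real (sqrt 2) * complex_coords r \<omega> z j)))
       (\<lambda>i j. \<i> * complex_of_real (\<nu> / (2 * pi)) * complex_of_real (gram \<omega> i j))
    = (\<Sum>\<^sub>\<infinity>n\<in>{..<r} \<rightarrow>\<^sub>E UNIV.
        exp (2 * \<i> * complex_of_real pi * complex_of_real (lattice_point r \<omega> n \<bullet> v)) *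
        translation_factor \<nu> z (lattice_point r \<omega> n) x)"
  unfolding riemann_theta_def
proof (rule infsum_cong)
  fix n :: "nat \<Rightarrow> int"
  \<comment> \<open>The \<open>0\<close> is the first characteristic, kept so that the terms match
    the unfolded theta series.\<close>
  let ?\<gamma> = "lattice_point r \<omega> n" and ?n = "\<lambda>i. complex_of_real (0 + of_int (n i))"
  let ?c = "\<i> * complex_of_real (\<nu> / (2 * pi))"
  have quad: "(\<Sum>i<r. \<Sum>j<r. ?n i * (?c * complex_of_real (gram \<omega> i j)) * ?n j)
      = ?c * complex_of_real ((norm ?\<gamma>)\<^sup>2)"
    unfolding power2_norm_eq_inner lattice_point_def inner_sum_left inner_sum_right
    by (simp add: gram_def sum_distrib_left sum_distrib_right mult_ac inner_commute)
  have lin: "(\<Sum>j<r. complex_of_real (gram \<omega> i j) *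
            (complex_of_real (real_coords r \<omega> x j)
              - complex_of_real (sqrt 2) * complex_coords r \<omega> z j))
        = complex_of_real (\<omega> i \<bullet> x) - complex_of_real (sqrt 2) * cdot z (cvec (\<omega> i))" if "i < r" for i
    unfolding sum_gram_real_coords[OF inj indep that, symmetric]
      sum_gram_complex_coords[OF inj indep that, symmetric]
    by (simp add: right_diff_distrib sum_subtractf sum_distrib_left mult_ac)
  have gb: "(\<Sum>j<r. gram \<omega> i j * \<beta> j) = \<omega> i \<bullet> v" for i
    by (simp add: v gram_def inner_sum_right mult.commute)
  have "(\<Sum>i<r. ?n i * (?c * (\<Sum>j<r. complex_of_real (gram \<omega> i j) *
            (complex_of_real (real_coords r \<omega> x j)
              - complex_of_real (sqrt 2) * complex_coords r \<omega> z j)) + complex_of_real (\<Sum>j<r. gram \<omega> i j * \<beta> j)))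
      = (\<Sum>i<r. ?n i * (?c * (complex_of_real (\<omega> i \<bullet> x) - complex_of_real (sqrt 2) * cdot z (cvec (\<omega> i)))
          + complex_of_real (\<omega> i \<bullet> v)))"
    by (rule sum.cong[OF refl]) (simp only: lin lessThan_iff gb)
  also have "\<dots> = ?c * (complex_of_real (?\<gamma> \<bullet> x) - complex_of_real (sqrt 2) * cdot z (cvec ?\<gamma>)) + complex_of_real (?\<gamma> \<bullet> v)"
    by (simp add: lattice_point_def inner_sum_left cvec_sum cvec_scaleR cdot_sum_right cdot_scale_right
        sum_distrib_left right_diff_distrib distrib_left sum.distrib sum_subtractf mult_ac)
  finally have lin_sum: "(\<Sum>i<r. ?n i * (?c * (\<Sum>j<r. complex_of_real (gram \<omega> i j) *
            (complex_of_real (real_coords r \<omega> x j)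
              - complex_of_real (sqrt 2) * complex_coords r \<omega> z j)) + complex_of_real (\<Sum>j<r. gram \<omega> i j * \<beta> j)))
      = ?c * (complex_of_real (?\<gamma> \<bullet> x) - complex_of_real (sqrt 2) * cdot z (cvec ?\<gamma>)) + complex_of_real (?\<gamma> \<bullet> v)" .
  note eqs = quad lin_sum
  show "exp (2 * \<i> * complex_of_real pi *
          (1 / 2 * (\<Sum>i<r. \<Sum>j<r. ?n i * (?c * complex_of_real (gram \<omega> i j)) * ?n j) +
           (\<Sum>i<r. ?n i * (?c * (\<Sum>j<r. complex_of_real (gram \<omega> i j) *
            (complex_of_real (real_coords r \<omega> x j)
              - complex_of_real (sqrt 2) * complex_coords r \<omega> z j)) + complex_of_real (\<Sum>j<r. gram \<omega> i j * \<beta> j)))))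
      = exp (2 * \<i> * complex_of_real pi * complex_of_real (?\<gamma> \<bullet> v)) * translation_factor \<nu> z ?\<gamma> x"
    unfolding eqs translation_factor_def exp_add[symmetric]
    by (rule arg_cong[where f=exp]) (simp add: field_simps inner_commute)
qed

text \<open>Integrability is stated on both sides because the Bochner integral of a non-integrable
  function is 0 by default, so the equation alone would not show that the integrals
  converge.\<close>

theorem theorem2p3:
  fixes r :: nat
    and \<omega> :: "nat \<Rightarrow> real ^ 'd"
    and \<Gamma> V \<Lambda>1 \<Lambda> :: "(real ^ 'd) set"
    and \<nu> :: real
    and ch :: "real ^ 'd \<Rightarrow> complex"
    and \<beta> :: "nat \<Rightarrow> real"
    and v :: "real ^ 'd"
    and \<phi> :: "real ^ 'd \<Rightarrow> complex"
  assumes "r \<le> CARD('d)"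
    and "inj_on \<omega> {..<r}" and "independent (\<omega> ` {..<r})"
    and "\<Gamma> = lattice r \<omega>" and "discrete \<Gamma>"
    and "V = span \<Gamma>"
    and "\<nu> > 0"
    and "unitary_character \<Gamma> ch"
    and "v = (\<Sum>i<r. \<beta> i *\<^sub>R \<omega> i)"
    and "\<And>\<gamma>. \<gamma> \<in> \<Gamma> \<Longrightarrow> ch \<gamma> = exp (2 * \<i> * complex_of_real pi * complex_of_real (inner \<gamma> v))"
    and "compact_fundamental_domain \<Gamma> V \<Lambda>1"
    and "\<Lambda> = cylinder V \<Lambda>1"
    and "\<phi> \<in> L2_space \<nu> \<Gamma> ch \<Lambda>"
  shows "\<forall>z :: complex ^ 'd.
      integrable lborel
        (\<lambda>x. bargmann_kernel \<nu> z x * \<phi> x * complex_of_real (exp (- \<nu> * (norm x)\<^sup>2))) \<and>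
      set_integrable lborel \<Lambda>
        (\<lambda>x. theta_kernel \<nu> r \<omega> \<beta> z x * \<phi> x * complex_of_real (exp (- \<nu> * (norm x)\<^sup>2))) \<and>
      segal_bargmann \<nu> \<phi> z =
        (LINT x:\<Lambda>|lborel.
           theta_kernel \<nu> r \<omega> \<beta> z x * \<phi> x * complex_of_real (exp (- \<nu> * (norm x)\<^sup>2)))"
proof
  fix z :: "complex ^ 'd"
  note inj = assms(2) and indep = assms(3)
  let ?I = "{..<r} \<rightarrow>\<^sub>E (UNIV :: int set)"
  let ?t = "lattice_point r \<omega>"
  define g where "g = bargmann_integrand \<nu> \<phi> z"
  define e where "e n x = exp (2 * \<i> * complex_of_real pi * complex_of_real (?t n \<bullet> v)) *
      translation_factor \<nu> z (?t n) x" for n x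
  have bij: "bij_betw ?t ?I \<Gamma>" using bij_betw_lattice_point[OF inj indep] assms(4) by simp
  have t: "?t n \<in> \<Gamma>" if "n \<in> ?I" for n using bij that by (auto simp: bij_betw_def)
  have I: "countable ?I" by (intro countable_PiE) auto
  have D: "compact \<Lambda>1" using assms(11) by (simp add: compact_fundamental_domain_def)
  then have \<Lambda> [measurable]: "\<Lambda> \<in> sets borel" unfolding assms(12) by (intro borel_closed closed_cylinder)
  have V: "subspace V" unfolding assms(6) by (rule subspace_span)
  have tiling: "AE x in lborel. \<exists>!n. n \<in> ?I \<and> x - ?t n \<in> \<Lambda>"
    unfolding assms(12) by (rule AE_unique_translate[OF assms(11) V bij I])
  have [measurable]: "\<phi> \<in> borel_measurable borel" using assms(13) by (simp add: L2_space_def)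
  have gm: "g \<in> borel_measurable borel" unfolding g_def bargmann_integrand_def by measurable
  have gi: "set_integrable lborel \<Lambda> g"
    unfolding g_def by (rule set_integrable_bargmann_integrand[OF assms(7,13) \<Lambda>])
  have em: "e n \<in> borel_measurable borel" for n
    unfolding e_def translation_factor_def by measurable
  \<comment> \<open>The exceptional null set may depend on \<open>n\<close>, as each slice is
    treated separately in the unfolding.\<close>
  have quasi: "AE x in lborel. g (x + ?t n) = e n x * g x" if "n \<in> ?I" for n
  proof -
    have "AE x in lborel. \<phi> (x + ?t n)
        = ch (?t n) * complex_of_real (exp (\<nu> * inner (x + ?t n /\<^sub>R 2) (?t n))) * \<phi> x"
      using assms(13) t[OF that] unfolding L2_space_def by blast
    then show ?thesis
    proof eventually_elim
      case (elim x)
      from bargmann_integrand_translate[OF elim, of z] show ?case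
        by (simp add: g_def e_def assms(10)[OF t[OF that]])
    qed
  qed
  obtain K where K: "(\<Sum>i<r. \<bar>n i\<bar>) \<le> K * norm (\<Sum>i<r. n i *\<^sub>R \<omega> i)" for n
    using sum_abs_coords_le_norm[OF inj indep] by blast
  \<comment> \<open>This bounds only the component in \<open>V\<close>; \<open>\<Lambda>\<close>
    itself may be unbounded.\<close>
  obtain M where M: "\<And>x. x \<in> \<Lambda>1 \<Longrightarrow> norm x \<le> M"
    using compact_imp_bounded[OF D] unfolding bounded_iff by blast
  define C where "C = exp ((sqrt 2 * \<nu> * (\<Sum>j\<in>UNIV. cmod (z $ j)) + \<nu> * M + K)\<^sup>2 / (2 * \<nu>))"
  have bound: "cmod (e n x) \<le> C * exp (- (\<Sum>i<r. real_of_int \<bar>n i\<bar>))" if "n \<in> ?I" "x \<in> \<Lambda>" for n x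
  proof -
    obtain a b where ab: "x = a + b" "a \<in> \<Lambda>1" "b \<in> V\<^sup>\<bottom>"
      using \<open>x \<in> \<Lambda>\<close> by (auto simp: assms(12) cylinder_def)
    have "?t n \<in> V" unfolding assms(6) using t[OF that(1)] by (rule span_base)
    then have "x \<bullet> ?t n = a \<bullet> ?t n"
      using inner_orthogonal_comp[OF _ ab(3)] by (simp add: ab(1) inner_add_left inner_commute[of b])
    also have "\<bar>\<dots>\<bar> \<le> M * norm (?t n)"
      using Cauchy_Schwarz_ineq2[of a "?t n"] mult_right_mono[OF M[OF ab(2)] norm_ge_zero[of "?t n"]]
      by linarith
    finally have "cmod (translation_factor \<nu> z (?t n) x) \<le> C * exp (- (K * norm (?t n)))"
      unfolding C_def by (rule translation_factor_bound[OF assms(7)])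
    also have "\<dots> \<le> C * exp (- (\<Sum>i<r. real_of_int \<bar>n i\<bar>))"
      using K[of "\<lambda>i. real_of_int (n i)"] by (simp add: C_def lattice_point_def)
    \<comment> \<open>The character value has modulus 1, its exponent being purely
      imaginary.\<close>
    finally show ?thesis by (simp add: e_def norm_mult)
  qed
  have E: "integrable (count_space ?I) (\<lambda>n. C * exp (- (\<Sum>i<r. real_of_int \<bar>n i\<bar>)))"
    by (intro integrable_mult_right integrable_exp_neg_l1_int) simp
  \<comment> \<open>Here \<open>g\<close> is also the function \<open>k\<close> of the unfolding
    lemma: integrability on \<open>\<Lambda>\<close> goes in, integrability on the whole space comes
    out.\<close>
  have unfolded: "integrable lborel g" "set_integrable lborel \<Lambda> (\<lambda>x. (\<Sum>\<^sub>\<infinity>n\<in>?I. e n x) * g x)"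
    "integral\<^sup>L lborel g = (LINT x:\<Lambda>|lborel. (\<Sum>\<^sub>\<infinity>n\<in>?I. e n x) * g x)"
    by (rule integral_unfold_tiling[OF I \<Lambda> gm tiling gi em quasi bound E]; assumption)+
  let ?c = "complex_of_real ((\<nu> / pi) powr (3 * real CARD('d) / 4))"
  have theta: "theta_kernel \<nu> r \<omega> \<beta> z x * \<phi> x * complex_of_real (exp (- \<nu> * (norm x)\<^sup>2))
      = ?c * ((\<Sum>\<^sub>\<infinity>n\<in>?I. e n x) * g x)" for x
    unfolding theta_kernel_def riemann_theta_eq_infsum[OF inj indep assms(9)]
    by (simp add: g_def bargmann_integrand_def e_def mult_ac)
  have g: "(\<lambda>x. bargmann_kernel \<nu> z x * \<phi> x * complex_of_real (exp (- \<nu> * (norm x)\<^sup>2))) = g"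
    by (simp add: g_def bargmann_integrand_def fun_eq_iff)
  show "integrable lborel
        (\<lambda>x. bargmann_kernel \<nu> z x * \<phi> x * complex_of_real (exp (- \<nu> * (norm x)\<^sup>2))) \<and>
      set_integrable lborel \<Lambda>
        (\<lambda>x. theta_kernel \<nu> r \<omega> \<beta> z x * \<phi> x * complex_of_real (exp (- \<nu> * (norm x)\<^sup>2))) \<and>
      segal_bargmann \<nu> \<phi> z =
        (LINT x:\<Lambda>|lborel.
           theta_kernel \<nu> r \<omega> \<beta> z x * \<phi> x * complex_of_real (exp (- \<nu> * (norm x)\<^sup>2)))"
    unfolding theta segal_bargmann_def g
    unfolding set_integral_mult_right
    by (intro conjI set_integrable_mult_right unfolded(1,2) arg_cong[OF unfolded(3)])
qed

end
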